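(* Let $\phi:\mathbb D\to\mathbb D$ be holomorphic, where $\mathbb D$ is the open unit disk, and let $C_\phi:H(\mathbb D)\to H(\mathbb D)$, $C_\phi f=f\circ\phi$, where $H(\mathbb D)$ is the Fréchet space of holomorphic functions on $\mathbb D$ with the topology of uniform convergence on compact subsets. Then $C_\phi$ is recurrent if and only if either $\phi$ is univalent (holomorphic and one-to-one) and has no fixed point in $\mathbb D$, or $\phi$ is an elliptic automorphism of $\mathbb D$.
   Context: A continuous linear operator $T$ on a Fréchet space $Y$ is recurrent if for every non-empty open $U\subset Y$ there is a positive integer $k$ with $U\cap T^{-k}(U)\neq\emptyset$. A conformal automorphism of $\mathbb D$ is a linear fractional map $z\mapsto(az+b)/(cz+d)$ ($ad-bc\neq0$) mapping $\mathbb D$ onto $\mathbb D$; it is an elliptic automorphism if it has a fixed point $\alpha\in\mathbb D$ (its second fixed point then lies in $\hat{\mathbb C}\setminus\overline{\mathbb D}$). *)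

theory Defs
  imports "HOL-Analysis.Analysis"
begin

abbreviation unit_disk :: "complex set" where
  "unit_disk \<equiv> ball 0 1"

text \<open>The space H(D): holomorphic functions on the disk (values outside the disk are
irrelevant; open sets below are automatically saturated w.r.t. equality on the disk).\<close>
definition HD :: "(complex \<Rightarrow> complex) set" where
  "HD = {f. f holomorphic_on unit_disk}"

definition HD_open :: "(complex \<Rightarrow> complex) set \<Rightarrow> bool" where
  "HD_open U \<longleftrightarrow> U \<subseteq> HD \<and>
     (\<forall>f\<in>U. \<exists>K e. compact K \<and> K \<subseteq> unit_disk \<and> e > 0 \<and>
        (\<forall>g\<in>HD. (\<forall>z\<in>K. cmod (g z - f z) < e) \<longrightarrow> g \<in> U))"

definition comp_op :: "(complex \<Rightarrow> complex) \<Rightarrow> (complex \<Rightarrow> complex) \<Rightarrow> (complex \<Rightarrow> complex)" where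
  "comp_op \<phi> f = f \<circ> \<phi>"

definition HD_recurrent :: "((complex \<Rightarrow> complex) \<Rightarrow> (complex \<Rightarrow> complex)) \<Rightarrow> bool" where
  "HD_recurrent T \<longleftrightarrow>
     (\<forall>U. HD_open U \<and> U \<noteq> {} \<longrightarrow> (\<exists>k::nat. k > 0 \<and> (\<exists>f\<in>U. (T ^^ k) f \<in> U)))"

definition disk_mobius_aut :: "(complex \<Rightarrow> complex) \<Rightarrow> bool" where
  "disk_mobius_aut \<phi> \<longleftrightarrow>
     (\<exists>a b c d. a * d - b * c \<noteq> 0 \<and>
        (\<forall>z\<in>unit_disk. c * z + d \<noteq> 0 \<and> \<phi> z = (a * z + b) / (c * z + d)) \<and>
        \<phi> ` unit_disk = unit_disk)"

definition elliptic_aut :: "(complex \<Rightarrow> complex) \<Rightarrow> bool" where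
  "elliptic_aut \<phi> \<longleftrightarrow> disk_mobius_aut \<phi> \<and> (\<exists>\<alpha>\<in>unit_disk. \<phi> \<alpha> = \<alpha>)"

end

theory Submission
  imports Defs "HOL-Complex_Analysis.Complex_Analysis"
begin

text \<open>
  If \<open>C\<^sub>\<phi>\<close> is recurrent, then \<open>\<phi>\<close> is injective because the condition \<open>f a \<noteq> f b\<close> is open, and
  at a fixed point \<open>\<alpha>\<close> one has \<open>\<bar>\<phi>' \<alpha>\<bar> \<ge> 1\<close>, because otherwise no \<open>f\<close> with
  \<open>\<bar>\<phi>' \<alpha>\<bar> < \<bar>f' \<alpha>\<bar> < 1\<close> can return; by the Schwarz lemma \<open>\<phi>\<close> is then conjugate to a rotation.
  Conversely, rotations have iterates close to the identity. If \<open>\<phi>\<close> is injective without fixed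
  points, some iterate \<open>\<psi>\<close> moves a given closed disk \<open>K\<close> off itself. As the complement of
  \<open>K \<union> \<psi> K\<close> is connected, Runge's argument gives a holomorphic \<open>g\<close> that is close to \<open>f\<close> on \<open>K\<close>
  and close to \<open>f \<circ> \<psi>\<^sup>-\<^sup>1\<close> on \<open>\<psi> K\<close>, so that both \<open>g\<close> and \<open>g \<circ> \<psi>\<close> are close to \<open>f\<close>.
\<close>

subsection \<open>Uniform approximation and pole pushing\<close>

text \<open>The approximants are holomorphic on all of \<open>S\<close>, not only near
  \<open>X\<close>; with \<open>S\<close> the disk they take the place of the polynomials in Runge's
  theorem.\<close>

definition approximable :: "complex set \<Rightarrow> complex set \<Rightarrow> (complex \<Rightarrow> complex) \<Rightarrow> bool" where
  "approximable S X u \<longleftrightarrow>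
     (\<forall>e>0. \<exists>g. g holomorphic_on S \<and> (\<forall>w\<in>X. cmod (g w - u w) < e))"

lemma approximable_holomorphic: "u holomorphic_on S \<Longrightarrow> approximable S X u"
  unfolding approximable_def by force

lemma approximable_closed:
  assumes "\<And>e. e > 0 \<Longrightarrow> \<exists>v. approximable S X v \<and> (\<forall>w\<in>X. cmod (v w - u w) < e)"
  shows "approximable S X u"
  unfolding approximable_def
proof (intro allI impI)
  fix e :: real assume "e > 0"
  then obtain v where v: "approximable S X v" "\<And>w. w \<in> X \<Longrightarrow> cmod (v w - u w) < e/2"
    using assms[of "e/2"] by auto
  then obtain g where g: "g holomorphic_on S" "\<And>w. w \<in> X \<Longrightarrow> cmod (g w - v w) < e/2"
    using \<open>e > 0\<close> unfolding approximable_def by (metis half_gt_zero)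
  have "cmod (g w - u w) < e" if "w \<in> X" for w
    using norm_triangle_lt[of "g w - v w" "v w - u w" e] g(2)[OF that] v(2)[OF that] by simp
  with g show "\<exists>g. g holomorphic_on S \<and> (\<forall>w\<in>X. cmod (g w - u w) < e)" by blast
qed

text \<open>An approximant within distance 1 is continuous, hence bounded, on the compact
  \<open>X\<close>. Products need this bound.\<close>

lemma approximable_bounded:
  assumes "approximable S X u" "compact X" "X \<subseteq> S"
  obtains B where "B > 0" "\<And>w. w \<in> X \<Longrightarrow> cmod (u w) < B"
proof -
  obtain g where g: "g holomorphic_on S" "\<And>w. w \<in> X \<Longrightarrow> cmod (g w - u w) < 1"
    using assms(1) unfolding approximable_def by (metis zero_less_one)
  have "continuous_on X g"
    using g(1) assms(3) holomorphic_on_imp_continuous_on continuous_on_subset by blast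
  then have "bounded (g ` X)"
    using assms(2) compact_continuous_image compact_imp_bounded by blast
  then obtain B where B: "B > 0" "\<And>w. w \<in> X \<Longrightarrow> cmod (g w) \<le> B"
    unfolding bounded_pos by auto
  have "cmod (u w) < B + 1" if "w \<in> X" for w
    using norm_triangle_sub[of "u w" "g w"] B(2)[OF that] g(2)[OF that]
    by (simp add: norm_minus_commute)
  with B(1) show thesis by (intro that[of "B + 1"]) auto
qed

lemma approximable_add:
  assumes "approximable S X u" "approximable S X v"
  shows "approximable S X (\<lambda>w. u w + v w)"
  unfolding approximable_def
proof (intro allI impI)
  fix e :: real assume "e > 0"
  then obtain g h where g: "g holomorphic_on S" "\<And>w. w \<in> X \<Longrightarrow> cmod (g w - u w) < e/2"
    and h: "h holomorphic_on S" "\<And>w. w \<in> X \<Longrightarrow> cmod (h w - v w) < e/2"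
    using assms unfolding approximable_def by (metis half_gt_zero)
  have "cmod (g w + h w - (u w + v w)) < e" if "w \<in> X" for w
    using norm_triangle_lt[of "g w - u w" "h w - v w" e] g(2)[OF that] h(2)[OF that]
    by (simp add: algebra_simps)
  moreover have "(\<lambda>w. g w + h w) holomorphic_on S"
    by (intro holomorphic_intros g h)
  ultimately show "\<exists>f. f holomorphic_on S \<and> (\<forall>w\<in>X. cmod (f w - (u w + v w)) < e)"
    by blast
qed

lemma approximable_mult:
  assumes "approximable S X u" "approximable S X v" "compact X" "X \<subseteq> S"
  shows "approximable S X (\<lambda>w. u w * v w)"
  unfolding approximable_def
proof (intro allI impI)
  fix e :: real assume "e > 0"
  obtain A where A: "A > 0" "\<And>w. w \<in> X \<Longrightarrow> cmod (u w) < A"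
    using approximable_bounded[OF assms(1,3,4)] by blast
  obtain B where B: "B > 0" "\<And>w. w \<in> X \<Longrightarrow> cmod (v w) < B"
    using approximable_bounded[OF assms(2,3,4)] by blast
  \<comment> \<open>\<open>d \<le> 1\<close> keeps \<open>cmod (g w)\<close> below
    \<open>A + 1\<close>; the error of the product is then below
    \<open>d * (A + B + 1) \<le> e\<close>.\<close>
  define d where "d = min 1 (e / (A + B + 1))"
  have d: "d > 0" "d \<le> 1" "d \<le> e / (A + B + 1)"
    using A(1) B(1) \<open>e > 0\<close> by (auto simp: d_def)
  then have d3: "d * (A + B + 1) \<le> e"
    using A(1) B(1) by (subst (asm) pos_le_divide_eq) auto
  obtain g h where g: "g holomorphic_on S" "\<And>w. w \<in> X \<Longrightarrow> cmod (g w - u w) < d"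
    and h: "h holomorphic_on S" "\<And>w. w \<in> X \<Longrightarrow> cmod (h w - v w) < d"
    using assms(1,2) d(1) unfolding approximable_def by metis
  have "cmod (g w * h w - u w * v w) < e" if w: "w \<in> X" for w
  proof -
    have "cmod (g w) \<le> A + 1"
      using norm_triangle_sub[of "g w" "u w"] A(2)[OF w] g(2)[OF w] d(2) by simp
    then have "cmod (g w * (h w - v w)) \<le> (A + 1) * d"
      unfolding norm_mult using h(2)[OF w] A(1) by (intro mult_mono) auto
    moreover have "cmod ((g w - u w) * v w) < d * B"
      unfolding norm_mult using g(2)[OF w] B(2)[OF w] d(1) by (intro mult_strict_mono) auto
    ultimately have "cmod (g w * (h w - v w) + (g w - u w) * v w) < d * (A + B + 1)"
      by (intro norm_triangle_lt) (simp add: algebra_simps)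
    then show ?thesis using d3 by (simp add: algebra_simps)
  qed
  moreover have "(\<lambda>w. g w * h w) holomorphic_on S"
    by (intro holomorphic_intros g h)
  ultimately show "\<exists>f. f holomorphic_on S \<and> (\<forall>w\<in>X. cmod (f w - u w * v w) < e)"
    by blast
qed

lemma approximable_power:
  assumes "approximable S X u" "compact X" "X \<subseteq> S"
  shows "approximable S X (\<lambda>w. u w ^ n)"
proof (induction n)
  case 0 show ?case by (auto intro: approximable_holomorphic)
next
  case (Suc n) then show ?case using approximable_mult[OF assms(1) Suc assms(2,3)] by simp
qed

lemma approximable_cmult:
  assumes "approximable S X u" "compact X" "X \<subseteq> S"
  shows "approximable S X (\<lambda>w. c * u w)"
  by (rule approximable_mult[OF approximable_holomorphic assms]) auto

lemma approximable_sum: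
  assumes "\<And>i. i \<in> I \<Longrightarrow> approximable S X (u i)"
  shows "approximable S X (\<lambda>w. \<Sum>i\<in>I. u i w)"
  using assms
proof (induction I rule: infinite_finite_induct)
  case (insert i I)
  then show ?case by (simp add: approximable_add)
qed (auto intro: approximable_holomorphic)

text \<open>Expand \<open>1 / (w - q)\<close> in a geometric series around \<open>p\<close>.\<close>
lemma approximable_push_pole:
  assumes X: "compact X" "X \<subseteq> S"
    and p: "approximable S X (\<lambda>w. 1 / (w - p))"
    and d: "\<And>w. w \<in> X \<Longrightarrow> d \<le> cmod (w - p)" "cmod (q - p) < d"
  shows "approximable S X (\<lambda>w. 1 / (w - q))"
proof (rule approximable_closed)
  fix e :: real assume "e > 0"
  define s where "s = cmod (q - p) / d"
  have d0: "d > 0" using d(2) by (meson norm_ge_zero order_le_less_trans)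
  have s: "0 \<le> s" "s < 1" using d(2) d0 by (auto simp: s_def)
  \<comment> \<open>\<open>m\<close> bounds \<open>cmod (w - q)\<close> from below on
    \<open>X\<close> and \<open>s\<close> bounds the ratio of the series, so the tail after
    \<open>N\<close> terms is at most \<open>s ^ N / m\<close>.\<close>
  define m where "m = d - cmod (q - p)"
  have m: "m > 0" using d(2) by (simp add: m_def)
  obtain N where N: "s ^ N < e * m"
    using s real_arch_pow_inv[of "e * m" s] \<open>e > 0\<close> m by auto
  \<comment> \<open>This partial sum is a polynomial in \<open>1 / (w - p)\<close>, hence
    approximable.\<close>
  define v where "v = (\<lambda>w. \<Sum>n<N. (q - p) ^ n * (1 / (w - p)) ^ Suc n)"
  have "approximable S X v"
    unfolding v_def by (intro approximable_sum approximable_cmult approximable_power p X)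
  moreover have "cmod (v w - 1 / (w - q)) < e" if w: "w \<in> X" for w
  proof -
    have dw: "d \<le> cmod (w - p)" by (rule d(1)[OF w])
    have wp: "w - p \<noteq> 0" using dw d0 by auto
    have "cmod (w - p) \<le> cmod (w - q) + cmod (q - p)"
      using norm_triangle_ineq[of "w - q" "q - p"] by simp
    with dw have mw: "m \<le> cmod (w - q)" by (simp add: m_def)
    have wq: "w - q \<noteq> 0" using mw m by auto
    define x where "x = (q - p) / (w - p)"
    have x1: "x \<noteq> 1" using wp wq by (auto simp: x_def)
    have "v w = (1 / (w - p)) * (\<Sum>n<N. x ^ n)"
      unfolding v_def x_def sum_distrib_left
      by (intro sum.cong) (auto simp: power_divide divide_simps)
    also have "\<dots> = (1 / (w - p)) * ((1 - x ^ N) / (1 - x))"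
      using x1 by (simp add: sum_gp_strict)
    also have "1 - x = (w - q) / (w - p)" using wp by (simp add: x_def field_simps)
    also have "(1 / (w - p)) * ((1 - x ^ N) / ((w - q) / (w - p))) = (1 - x ^ N) / (w - q)"
      using wp by simp
    finally have "v w - 1 / (w - q) = - (x ^ N) / (w - q)"
      by (simp add: diff_divide_distrib)
    then have "cmod (v w - 1 / (w - q)) = cmod x ^ N / cmod (w - q)"
      by (simp add: norm_divide norm_power)
    also have "\<dots> \<le> s ^ N / m"
    proof (intro frac_le power_mono)
      show "cmod x \<le> s"
        using dw d0 unfolding x_def s_def norm_divide by (intro divide_left_mono mult_pos_pos) auto
    qed (use m mw s in auto)
    also have "\<dots> < e" using N m by (simp add: field_simps)
    finally show ?thesis .
  qed
  ultimately show "\<exists>v. approximable S X v \<and> (\<forall>w\<in>X. cmod (v w - 1 / (w - q)) < e)" by blast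
qed

text \<open>The admissible poles form a set that is open and closed in the connected complement of
  \<open>X\<close>. It contains \<open>a\<close>, because \<open>1 / (w - a)\<close> is itself
  holomorphic on \<open>S\<close>.\<close>

lemma approximable_inverse:
  assumes X: "compact X" "X \<subseteq> S" "connected (- X)" and "a \<notin> S" "p \<notin> X"
  shows "approximable S X (\<lambda>w. 1 / (w - p))"
\<comment> \<open>\<open>infdist\<close> to the empty set is 0, so the distances below are positive
  only for nonempty \<open>X\<close>.\<close>
proof (cases "X = {}")
  case True
  then show ?thesis by (auto simp: approximable_def intro: holomorphic_on_const)
next
  case False
  define P where "P = {p \<in> - X. approximable S X (\<lambda>w. 1 / (w - p))}"
  have pos: "infdist q X > 0" if "q \<in> - X" for q
    using that X(1) False compact_imp_closed infdist_pos_not_in_closed by auto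
  have step: "q \<in> P" if "p \<in> P" "q \<in> - X" "cmod (q - p) < infdist p X" for p q
    using approximable_push_pole[OF X(1,2), of p "infdist p X" q] that infdist_le[of _ X p]
    unfolding P_def by (auto simp: dist_norm norm_minus_commute)
  have "a \<in> P"
    using \<open>a \<notin> S\<close> X(2) unfolding P_def
    by (auto intro!: approximable_holomorphic holomorphic_intros)
  moreover have "openin (top_of_set (- X)) P"
    unfolding openin_euclidean_subtopology_iff
  proof (intro conjI ballI)
    fix p assume p: "p \<in> P"
    show "\<exists>e>0. \<forall>q\<in>- X. dist q p < e \<longrightarrow> q \<in> P"
      using step[OF p] pos[of p] p unfolding P_def dist_norm by blast
  qed (auto simp: P_def)
  moreover have "openin (top_of_set (- X)) (- X - P)"
    unfolding openin_euclidean_subtopology_iff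
  proof (intro conjI ballI)
    fix q assume q: "q \<in> - X - P"
    show "\<exists>e>0. \<forall>p\<in>- X. dist p q < e \<longrightarrow> p \<in> - X - P"
    \<comment> \<open>A point \<open>p\<close> of \<open>P\<close> this close to \<open>q\<close>
      would be farther from \<open>X\<close> than from \<open>q\<close>, and \<open>step\<close>
      would then put \<open>q\<close> into \<open>P\<close>.\<close>
    proof (intro exI[of _ "infdist q X / 2"] conjI ballI impI)
      fix p assume p: "p \<in> - X" "dist p q < infdist q X / 2"
      have "infdist q X \<le> infdist p X + dist p q"
        using infdist_triangle[of q X p] by (simp add: dist_commute)
      then have "cmod (q - p) < infdist p X"
        using p(2) by (simp add: dist_norm norm_minus_commute)
      then show "p \<in> - X - P" using step[of p q] q p(1) by blast
    qed (use pos[of q] q in auto)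
  qed auto
  ultimately have "P = - X"
    using X(3) unfolding connected_openin by (auto simp: P_def)
  then show ?thesis using \<open>p \<notin> X\<close> by (auto simp: P_def)
qed

text \<open>Riemann sums are finite combinations of the \<open>G t\<close>, and by uniform
  continuity of \<open>G\<close> they converge to the integral uniformly on
  \<open>X\<close>.\<close>

lemma approximable_integral:
  fixes G :: "real \<Rightarrow> complex \<Rightarrow> complex"
  assumes X: "compact X" "X \<subseteq> S"
    and cont: "continuous_on ({0..1} \<times> X) (\<lambda>(t,w). G t w)"
    and app: "\<And>t. t \<in> {0..1} \<Longrightarrow> approximable S X (G t)"
  shows "approximable S X (\<lambda>w. integral {0..1} (\<lambda>t. G t w))"
proof (rule approximable_closed)
  fix e :: real assume "e > 0"
  have "uniformly_continuous_on ({0..1} \<times> X) (\<lambda>(t,w). G t w)"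
    using cont X(1) by (intro compact_uniformly_continuous compact_Times) auto
  then obtain d where d: "d > 0" and dG:
    "\<And>s t w. s \<in> {0..1} \<Longrightarrow> t \<in> {0..1} \<Longrightarrow> w \<in> X \<Longrightarrow> \<bar>s - t\<bar> < d \<Longrightarrow> cmod (G s w - G t w) < e/2"
  proof -
    from \<open>uniformly_continuous_on _ _\<close> \<open>e > 0\<close>
    obtain d where "d > 0" and d: "\<And>x y. x \<in> {0..1} \<times> X \<Longrightarrow> y \<in> {0..1} \<times> X \<Longrightarrow> dist y x < d \<Longrightarrow>
        dist (case y of (t, w) \<Rightarrow> G t w) (case x of (t, w) \<Rightarrow> G t w) < e/2"
      unfolding uniformly_continuous_on_def by (metis half_gt_zero)
    show thesis
    proof (rule that[OF \<open>d > 0\<close>])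
      fix s t :: real and w assume "s \<in> {0..1}" "t \<in> {0..1}" "w \<in> X" "\<bar>s - t\<bar> < d"
      then show "cmod (G s w - G t w) < e/2"
        using d[of "(t, w)" "(s, w)"] by (simp add: dist_prod_def dist_norm)
    qed
  qed
  obtain N :: nat where N: "N > 0" "1 / real N < d"
    using d by (metis nat_approx_posE zero_less_Suc)
  have int: "(\<lambda>t. G t w) integrable_on {a..b}" if "w \<in> X" "0 \<le> a" "b \<le> 1" for a b w
  proof (intro integrable_continuous_real continuous_on_subset[of "{0..1}" _ "{a..b}"])
    show "continuous_on {0..1} (\<lambda>t. G t w)"
      using continuous_on_compose2[OF cont, of "{0..1}" "\<lambda>t. (t, w)"] that(1)
      by (simp add: image_subset_iff continuous_on_Pair)
  qed (use that in auto)
  \<comment> \<open>Left-endpoint sums over the first \<open>n\<close> of \<open>N\<close>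
    intervals; each interval contributes an error of at most \<open>(e/2) / N\<close>, which the
    induction on \<open>n\<close> adds up.\<close>
  define v where "v = (\<lambda>n w. \<Sum>j<n. (1 / of_nat N) * G (real j / real N) w)"
  have "cmod (v n w - integral {0..real n / real N} (\<lambda>t. G t w)) \<le> (e/2) * (real n / real N)"
    if "n \<le> N" "w \<in> X" for n w
    using that
  proof (induction n)
    case 0 then show ?case by (simp add: v_def)
  next
    case (Suc n)
    let ?a = "real n / real N" and ?b = "real (Suc n) / real N"
    have ab: "0 \<le> ?a" "?a \<le> ?b" "?b \<le> 1" "?b - ?a = 1 / real N"
      using Suc.prems N by (auto simp: field_simps)
    have "integral {0..?b} (\<lambda>t. G t w)
        = integral {0..?a} (\<lambda>t. G t w) + integral {?a..?b} (\<lambda>t. G t w)"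
      using ab int[OF Suc.prems(2), of 0 ?b]
      by (intro Henstock_Kurzweil_Integration.integral_combine[symmetric]) auto
    moreover have "cmod ((1 / of_nat N) * G ?a w - integral {?a..?b} (\<lambda>t. G t w)) \<le> (e/2) * (1 / real N)"
    proof -
      have "((\<lambda>t. G ?a w) has_integral (?b - ?a) *\<^sub>R G ?a w) {?a..?b}"
        using has_integral_const_real[of "G ?a w" ?a ?b] ab by simp
      then have "((\<lambda>t. G ?a w - G t w) has_integral
          (?b - ?a) *\<^sub>R G ?a w - integral {?a..?b} (\<lambda>t. G t w)) {?a..?b}"
        using int[OF Suc.prems(2), of ?a ?b] ab
        by (intro has_integral_diff integrable_integral) auto
      then have "norm ((?b - ?a) *\<^sub>R G ?a w - integral {?a..?b} (\<lambda>t. G t w)) \<le> (e/2) * measure lborel {?a..?b}"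
      proof (rule has_integral_bound_real[rotated 2])
        fix t assume "t \<in> {?a..?b} - {}"
        then have "t \<in> {0..1}" "?a \<in> {0..1}" "\<bar>?a - t\<bar> < d"
          using ab N(2) order_trans[OF ab(1), of t] by auto
        then show "cmod (G ?a w - G t w) \<le> e/2"
          using dG Suc.prems(2) less_imp_le by blast
      qed (use \<open>e > 0\<close> in auto)
      then show ?thesis unfolding ab(4) using ab by (simp add: scaleR_conv_of_real)
    qed
    moreover have "v (Suc n) w = v n w + (1 / of_nat N) * G ?a w"
      by (simp add: v_def)
    moreover have "cmod (v n w - integral {0..?a} (\<lambda>t. G t w)) \<le> (e/2) * ?a"
      using Suc by simp
    ultimately have "cmod (v (Suc n) w - integral {0..?b} (\<lambda>t. G t w))
        \<le> (e/2) * ?a + (e/2) * (1 / real N)"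
      by (simp only: add_diff_add norm_triangle_mono)
    also have "\<dots> = (e/2) * ?b" by (simp add: add_divide_distrib distrib_left)
    finally show ?case .
  qed
  from this[of N] have "cmod (v N w - integral {0..1} (\<lambda>t. G t w)) < e" if "w \<in> X" for w
    using that N \<open>e > 0\<close> by fastforce
  moreover have "approximable S X (v N)"
    unfolding v_def using N
    by (intro approximable_sum approximable_cmult app X) (auto simp: field_simps)
  ultimately show "\<exists>v. approximable S X v \<and>
      (\<forall>w\<in>X. cmod (v w - integral {0..1} (\<lambda>t. G t w)) < e)" by blast
qed

subsection \<open>The pseudo-hyperbolic distance and escaping iterates\<close>

text \<open>With angle 0 the Moebius function is \<open>(z - w) / (1 - cnj w * z)\<close>, so this
  is the pseudo-hyperbolic distance.\<close>

definition pseudo_dist :: "complex \<Rightarrow> complex \<Rightarrow> real" where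
  "pseudo_dist z w = cmod (Moebius_function 0 w z)"

lemma one_minus_cnj_mult_nonzero:
  assumes "cmod z < 1" "cmod w < 1"
  shows "1 - cnj w * z \<noteq> 0"
proof -
  have "cmod (cnj w * z) < 1" using norm_mult_less[of "cnj w" 1 z 1] assms by simp
  then show ?thesis by auto
qed

lemma norm_one_minus_cnj_mult_sq:
  "(cmod (1 - cnj w * z))\<^sup>2 = 1 - 2 * (w \<bullet> z) + (cmod w)\<^sup>2 * (cmod z)\<^sup>2"
  by (simp add: cmod_power2 inner_complex_def) (simp add: power2_eq_square algebra_simps)

text \<open>Clear the denominator and expand both squared norms by the inner product. The identity
  turns a bound on the pseudo-hyperbolic distance into a bound on \<open>cmod z\<close>.\<close>

lemma pseudo_dist_sq:
  assumes "cmod z < 1" "cmod w < 1"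
  shows "(1 - (pseudo_dist z w)\<^sup>2) * (cmod (1 - cnj w * z))\<^sup>2
         = (1 - (cmod w)\<^sup>2) * (1 - (cmod z)\<^sup>2)"
proof -
  have "cmod (1 - cnj w * z) \<noteq> 0"
    using one_minus_cnj_mult_nonzero[OF assms] by simp
  then have "(pseudo_dist z w)\<^sup>2 * (cmod (1 - cnj w * z))\<^sup>2 = (cmod (z - w))\<^sup>2"
    by (simp add: pseudo_dist_def Moebius_function_simple norm_divide power_divide)
  moreover have "(cmod (z - w))\<^sup>2 = (cmod z)\<^sup>2 - 2 * (w \<bullet> z) + (cmod w)\<^sup>2"
    by (simp add: power2_norm_eq_inner algebra_simps inner_commute)
  ultimately show ?thesis
    by (simp add: norm_one_minus_cnj_mult_sq left_diff_distrib) (simp add: algebra_simps)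
qed

lemma pseudo_dist_0 [simp]: "pseudo_dist z 0 = cmod z" "pseudo_dist 0 z = cmod z"
  by (simp_all add: pseudo_dist_def Moebius_function_simple)

lemma Moebius_function_inverse:
  assumes "cmod w < 1" "cmod z < 1"
  shows "Moebius_function 0 (- w) (Moebius_function 0 w z) = z"
  using Moebius_function_compose[of "- w" w z] assms by simp

text \<open>Moebius maps that move \<open>w\<close> and \<open>\<phi> w\<close> to the origin turn
  \<open>\<phi>\<close> into a self-map of the disk fixing 0, to which the Schwarz lemma
  applies.\<close>

lemma Schwarz_Pick:
  assumes hol: "\<phi> holomorphic_on ball 0 1" and self: "\<phi> ` ball 0 1 \<subseteq> ball 0 1"
    and z: "cmod z < 1" and w: "cmod w < 1"
  shows "pseudo_dist (\<phi> z) (\<phi> w) \<le> pseudo_dist z w"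
proof -
  define h where "h = Moebius_function 0 (\<phi> w) \<circ> (\<phi> \<circ> Moebius_function 0 (- w))"
  have lt: "cmod (\<phi> x) < 1" if "cmod x < 1" for x
    using self that by (auto simp: image_subset_iff)
  have M: "cmod (Moebius_function 0 (- w) x) < 1" if "cmod x < 1" for x
    using Moebius_function_norm_lt_1[of "- w" x] w that by simp
  have "h holomorphic_on ball 0 1"
    unfolding h_def using Moebius_function_holomorphic[of "- w"] w M lt[OF w] self
    by (intro holomorphic_on_compose_gen[where t = "ball 0 1"] hol Moebius_function_holomorphic) auto
  moreover have "h 0 = 0"
    by (simp add: h_def Moebius_function_of_zero Moebius_function_eq_zero)
  moreover have "cmod (h x) < 1" if "cmod x < 1" for x
    using Moebius_function_norm_lt_1 lt[OF w] lt[OF M[OF that]] by (simp add: h_def)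
  moreover have "cmod (Moebius_function 0 w z) < 1"
    by (rule Moebius_function_norm_lt_1[OF w z])
  ultimately have "cmod (h (Moebius_function 0 w z)) \<le> cmod (Moebius_function 0 w z)"
    by (rule Schwarz_Lemma(1))
  then show ?thesis
    by (simp add: h_def pseudo_dist_def Moebius_function_inverse w z)
qed

text \<open>Pseudo-hyperbolic disks of radius \<open>r\<close> centred in \<open>cball 0 r\<close>
  stay in one compact disk: in \<open>pseudo_dist_sq\<close> the left side is at least
  \<open>m = (1 - r^2) * (1 - r)^2\<close>, and the right side is at most
  \<open>1 - (cmod z)^2\<close>.\<close>

lemma pseudo_dist_bound:
  assumes "0 \<le> r" "r < 1"
  obtains R where "0 \<le> R" "R < 1"
    "\<And>z w. cmod z < 1 \<Longrightarrow> cmod w \<le> r \<Longrightarrow> pseudo_dist z w \<le> r \<Longrightarrow> cmod z \<le> R"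
proof
  define m where "m = (1 - r\<^sup>2) * (1 - r)\<^sup>2"
  have r2: "0 < 1 - r\<^sup>2" "1 - r\<^sup>2 \<le> 1" using assms by (auto simp: power_less_one_iff abs_square_less_1)
  have r3: "0 < (1 - r)\<^sup>2" "(1 - r)\<^sup>2 \<le> 1" using assms by (auto simp: power_le_one)
  have m: "0 < m" "m \<le> 1" using r2 r3 by (auto simp: m_def mult_le_one)
  show "0 \<le> sqrt (1 - m)" "sqrt (1 - m) < 1" using m by auto
  fix z w :: complex assume z: "cmod z < 1" and w: "cmod w \<le> r" and pd: "pseudo_dist z w \<le> r"
  have w1: "cmod w < 1" using w assms by simp
  have "cmod (cnj w * z) \<le> r * 1"
    unfolding norm_mult using w z assms by (intro mult_mono) auto
  then have "1 - r \<le> cmod (1 - cnj w * z)"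
    using norm_triangle_ineq2[of 1 "cnj w * z"] by simp
  then have "(1 - r)\<^sup>2 \<le> (cmod (1 - cnj w * z))\<^sup>2" using assms by (intro power_mono) auto
  moreover have "(pseudo_dist z w)\<^sup>2 \<le> r\<^sup>2"
    using pd by (intro power_mono) (auto simp: pseudo_dist_def)
  ultimately have "m \<le> (1 - (pseudo_dist z w)\<^sup>2) * (cmod (1 - cnj w * z))\<^sup>2"
    unfolding m_def using r2 by (intro mult_mono) auto
  also have "\<dots> = (1 - (cmod w)\<^sup>2) * (1 - (cmod z)\<^sup>2)" by (rule pseudo_dist_sq[OF z w1])
  also have "\<dots> \<le> 1 * (1 - (cmod z)\<^sup>2)"
    using z by (intro mult_right_mono) (auto simp: abs_square_le_1)
  finally show "cmod z \<le> sqrt (1 - m)" by (intro real_le_rsqrt) simp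
qed

text \<open>Pseudo-hyperbolic disks are Euclidean: squaring the inequality and completing the square
  gives centre \<open>B * w\<close> and squared radius \<open>s\<close>.\<close>

lemma convex_pseudo_disk:
  assumes w: "cmod w < 1" and "0 \<le> \<rho>" "\<rho> < 1"
  shows "convex {z. cmod z < 1 \<and> pseudo_dist z w \<le> \<rho>}"
proof -
  define A where "A = 1 - \<rho>\<^sup>2 * (cmod w)\<^sup>2"
  define B where "B = (1 - \<rho>\<^sup>2) / A"
  define s where "s = B\<^sup>2 * (cmod w)\<^sup>2 - ((cmod w)\<^sup>2 - \<rho>\<^sup>2) / A"
  have "\<rho>\<^sup>2 < 1" "(cmod w)\<^sup>2 \<le> 1"
    using assms by (auto simp: abs_square_less_1 abs_square_le_1)
  then have "\<rho>\<^sup>2 * (cmod w)\<^sup>2 < 1"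
    by (smt (verit) mult_left_le zero_le_power2)
  then have A: "A > 0" by (simp add: A_def)
  have "pseudo_dist z w \<le> \<rho> \<longleftrightarrow> z \<in> {z. (cmod (z - of_real B * w))\<^sup>2 \<le> s}" if z: "cmod z < 1" for z
  proof -
    have "cmod (1 - cnj w * z) > 0" using one_minus_cnj_mult_nonzero[OF z w] by simp
    then have "pseudo_dist z w \<le> \<rho> \<longleftrightarrow> cmod (z - w) \<le> \<rho> * cmod (1 - cnj w * z)"
      by (simp add: pseudo_dist_def Moebius_function_simple norm_divide divide_le_eq)
    also have "\<dots> \<longleftrightarrow> (cmod (z - w))\<^sup>2 \<le> (\<rho> * cmod (1 - cnj w * z))\<^sup>2"
      using assms by (subst power_mono_iff) auto
    also have "\<dots> \<longleftrightarrow> A * (cmod z)\<^sup>2 - 2 * (1 - \<rho>\<^sup>2) * (w \<bullet> z) + (cmod w)\<^sup>2 - \<rho>\<^sup>2 \<le> 0"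
    proof -
      have "(cmod (z - w))\<^sup>2 = (cmod z)\<^sup>2 - 2 * (w \<bullet> z) + (cmod w)\<^sup>2"
        by (simp add: power2_norm_eq_inner algebra_simps inner_commute)
      then show ?thesis
        unfolding power_mult_distrib norm_one_minus_cnj_mult_sq A_def by argo
    qed
    also have "\<dots> \<longleftrightarrow> (cmod z)\<^sup>2 - 2 * B * (w \<bullet> z) + ((cmod w)\<^sup>2 - \<rho>\<^sup>2) / A \<le> 0"
    proof -
      have "A * (cmod z)\<^sup>2 - 2 * (1 - \<rho>\<^sup>2) * (w \<bullet> z) + (cmod w)\<^sup>2 - \<rho>\<^sup>2
        = A * ((cmod z)\<^sup>2 - 2 * B * (w \<bullet> z) + ((cmod w)\<^sup>2 - \<rho>\<^sup>2) / A)"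
        using A by (simp add: B_def field_simps)
      then show ?thesis using A by (simp only: mult_le_0_iff) auto
    qed
    also have "\<dots> \<longleftrightarrow> (cmod (z - of_real B * w))\<^sup>2 \<le> s"
    proof -
      have "(cmod (z - B *\<^sub>R w))\<^sup>2 = (cmod z)\<^sup>2 - 2 * B * (w \<bullet> z) + B\<^sup>2 * (cmod w)\<^sup>2"
        unfolding power2_norm_eq_inner
        by (simp add: algebra_simps inner_commute power2_eq_square)
      then show ?thesis unfolding s_def scaleR_conv_of_real by (intro iffI) linarith+
    qed
    finally show ?thesis by simp
  qed
  then have eq: "{z. cmod z < 1 \<and> pseudo_dist z w \<le> \<rho>}
      = ball 0 1 \<inter> {z. (cmod (z - of_real B * w))\<^sup>2 \<le> s}" by auto
  have "convex {z. (cmod (z - of_real B * w))\<^sup>2 \<le> s}"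
  \<comment> \<open>The sign of \<open>s\<close> is left open; a negative value gives the empty set,
    which is convex too.\<close>
  proof (cases "s \<ge> 0")
    case True
    then have "{z. (cmod (z - of_real B * w))\<^sup>2 \<le> s} = cball (of_real B * w) (sqrt s)"
      by (auto simp: dist_norm norm_minus_commute real_le_rsqrt)
        (metis norm_ge_zero power_mono real_sqrt_pow2)
    then show ?thesis by simp
  next
    case False
    then have "{z. (cmod (z - of_real B * w))\<^sup>2 \<le> s} = {}"
      by (auto simp: not_le) (meson less_le_trans not_less zero_le_power2)
    then show ?thesis by simp
  qed
  with eq show ?thesis by (simp add: convex_Int)
qed

section \<open>Iterates of a holomorphic self-map of the disk\<close>

lemma funpow_self:
  assumes "f ` S \<subseteq> S"
  shows "(f ^^ n) ` S \<subseteq> S"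
  using assms by (induction n) auto

lemma funpow_holomorphic:
  assumes "f holomorphic_on S" "f ` S \<subseteq> S"
  shows "(f ^^ n) holomorphic_on S"
proof (induction n)
  case 0
  show ?case by (simp add: holomorphic_on_id)
next
  case (Suc n)
  then show ?case
    using holomorphic_on_compose_gen[OF Suc assms(1)] funpow_self[OF assms(2)]
    by (simp only: funpow.simps)
qed

lemma funpow_inj_on:
  assumes "inj_on f S" "f ` S \<subseteq> S"
  shows "inj_on (f ^^ n) S"
proof (induction n)
  case (Suc n)
  then show ?case
    using comp_inj_on[OF Suc inj_on_subset[OF assms(1) funpow_self[OF assms(2)]]]
    by (simp only: funpow.simps)
qed auto

text \<open>If every iterate brought a point of \<open>cball 0 r\<close> back, the orbit of \<open>0\<close> would stay in
  a compact set. The points eventually close to this orbit would then form a bounded convex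
  invariant set, and Brouwer's theorem would give a fixed point in its closure.\<close>
lemma iterates_escape:
  assumes hol: "\<phi> holomorphic_on ball 0 1" and self: "\<phi> ` ball 0 1 \<subseteq> ball 0 1"
    and nofix: "\<And>z. cmod z < 1 \<Longrightarrow> \<phi> z \<noteq> z" and r: "0 \<le> r" "r < 1"
  obtains k where "k > 0" "(\<phi> ^^ k) ` cball 0 r \<inter> cball 0 r = {}"
proof -
  have False if ret: "\<And>k. k > 0 \<Longrightarrow> (\<phi> ^^ k) ` cball 0 r \<inter> cball 0 r \<noteq> {}"
  proof -
    define x where "x k = (\<phi> ^^ k) 0" for k
    \<comment> \<open>\<open>r'\<close> will bound the orbit of 0; the same bound applied to
      \<open>r'\<close> yields a radius \<open>R < 1\<close> for all the sets
      \<open>C n\<close>.\<close>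
    obtain r' where r': "0 \<le> r'" "r' < 1"
      "\<And>z w. cmod z < 1 \<Longrightarrow> cmod w \<le> r \<Longrightarrow> pseudo_dist z w \<le> r \<Longrightarrow> cmod z \<le> r'"
      using pseudo_dist_bound[OF r] by metis
    obtain R where R: "0 \<le> R" "R < 1"
      "\<And>z w. cmod z < 1 \<Longrightarrow> cmod w \<le> r' \<Longrightarrow> pseudo_dist z w \<le> r' \<Longrightarrow> cmod z \<le> R"
      using pseudo_dist_bound[OF r'(1,2)] by metis
    have x1: "cmod (x k) < 1" for k
      using funpow_self[OF self, of k] unfolding x_def by force
    have xr: "cmod (x k) \<le> r'" for k
    proof (cases "k = 0")
      case False
      then obtain z where z: "cmod z \<le> r" "cmod ((\<phi> ^^ k) z) \<le> r"
        using ret[of k] by auto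
      \<comment> \<open>By Schwarz-Pick for the iterate, \<open>x k\<close> lies within
        \<open>cmod z \<le> r\<close> of a point of \<open>cball 0 r\<close>.\<close>
      have "pseudo_dist (x k) ((\<phi> ^^ k) z) \<le> pseudo_dist 0 z"
        unfolding x_def using z r
        by (intro Schwarz_Pick funpow_holomorphic funpow_self hol self) auto
      with r'(3)[OF x1 z(2)] z(1) show ?thesis by simp
    qed (simp add: x_def r')
    \<comment> \<open>Since \<open>\<phi>\<close> shifts the orbit by one place, it maps
      \<open>C n\<close> into \<open>C (Suc n)\<close>; the increasing union of these convex sets is
      thus convex and invariant.\<close>
    define C where "C n = {z. \<forall>k\<ge>n. cmod z < 1 \<and> pseudo_dist z (x k) \<le> r'}" for n
    have C0: "0 \<in> C n" for n using xr by (simp add: C_def)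
    have C_mono: "C m \<subseteq> C n" if "m \<le> n" for m n using that by (auto simp: C_def)
    have C_R: "C n \<subseteq> cball 0 R" for n using R(3)[OF _ xr] by (force simp: C_def)
    have C_convex: "convex (C n)" for n
    proof -
      have "C n = (\<Inter>k\<in>{n..}. {z. cmod z < 1 \<and> pseudo_dist z (x k) \<le> r'})"
        by (auto simp: C_def)
      then show ?thesis using convex_pseudo_disk[OF x1 r'(1,2)] by (simp add: convex_INT)
    qed
    have C_step: "\<phi> z \<in> C (Suc n)" if "z \<in> C n" for z n
      unfolding C_def
    proof (intro CollectI allI impI)
      fix k assume "Suc n \<le> k"
      then obtain j where j: "k = Suc j" "n \<le> j" by (cases k) auto
      have z: "cmod z < 1" "pseudo_dist z (x j) \<le> r'" using that j by (auto simp: C_def)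
      have "pseudo_dist (\<phi> z) (\<phi> (x j)) \<le> pseudo_dist z (x j)"
        by (rule Schwarz_Pick[OF hol self z(1) x1])
      then show "cmod (\<phi> z) < 1 \<and> pseudo_dist (\<phi> z) (x k) \<le> r'"
        using z self by (auto simp: x_def j image_subset_iff)
    qed
    \<comment> \<open>The closure provides the compactness for Brouwer, and \<open>R < 1\<close>
      keeps it inside the open disk, where \<open>\<phi>\<close> has no fixed point.\<close>
    define E where "E = closure (\<Union>n. C n)"
    have E: "E \<subseteq> cball 0 R" unfolding E_def by (rule closure_minimal) (use C_R in auto)
    have E1: "E \<subseteq> ball 0 1" using E R by auto
    have "compact E" using E bounded_subset[OF bounded_cball E] by (simp add: E_def compact_eq_bounded_closed)
    moreover have "convex (\<Union>n. C n)"
    proof (rule convexI)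
      fix y z :: complex and u v :: real
      assume "y \<in> (\<Union>n. C n)" "z \<in> (\<Union>n. C n)" and uv: "0 \<le> u" "0 \<le> v" "u + v = 1"
      then obtain m n where "y \<in> C m" "z \<in> C n" by auto
      then have "y \<in> C (max m n)" "z \<in> C (max m n)"
        using C_mono[of m "max m n"] C_mono[of n "max m n"] by auto
      then show "u *\<^sub>R y + v *\<^sub>R z \<in> (\<Union>n. C n)"
        using convexD[OF C_convex _ _ uv] by blast
    qed
    then have "convex E" unfolding E_def by (rule convex_closure)
    moreover have "E \<noteq> {}" using C0 closure_subset unfolding E_def by blast
    moreover have contE: "continuous_on E \<phi>"
      using hol E1 holomorphic_on_imp_continuous_on continuous_on_subset by blast
    moreover have "\<phi> ` E \<subseteq> E"
      unfolding E_def
    proof (rule image_closure_subset)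
      show "continuous_on (closure (\<Union>n. C n)) \<phi>" using contE by (simp add: E_def)
      show "\<phi> ` (\<Union>n. C n) \<subseteq> closure (\<Union>n. C n)"
        by (rule image_subsetI, erule UN_E, rule subsetD[OF closure_subset],
            rule UN_I[OF UNIV_I], erule C_step)
    qed auto
    ultimately obtain z where "z \<in> E" "\<phi> z = z"
      using brouwer[of E \<phi>] by blast
    then show False using nofix E1 by force
  qed
  then show thesis using that by blast
qed

section \<open>Fixed points in the disk and the Schwarz lemma\<close>

text \<open>Moves the fixed point to 0 so that the Schwarz lemma applies. The derivatives of the two
  Moebius maps, \<open>1 - cnj \<alpha> * \<alpha>\<close> and its reciprocal, cancel in the chain
  rule.\<close>

lemma deriv_fixed_conjugate:
  assumes hol: "\<phi> holomorphic_on ball 0 1" and self: "\<phi> ` ball 0 1 \<subseteq> ball 0 1"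
    and a: "cmod \<alpha> < 1" "\<phi> \<alpha> = \<alpha>"
  defines "h \<equiv> Moebius_function 0 \<alpha> \<circ> (\<phi> \<circ> Moebius_function 0 (- \<alpha>))"
  shows "h holomorphic_on ball 0 1" "h 0 = 0" "\<And>z. cmod z < 1 \<Longrightarrow> cmod (h z) < 1"
    "deriv h 0 = deriv \<phi> \<alpha>"
proof -
  have M: "cmod (Moebius_function 0 (- \<alpha>) x) < 1" if "cmod x < 1" for x
    using Moebius_function_norm_lt_1[of "- \<alpha>" x] a that by simp
  show "h holomorphic_on ball 0 1"
    unfolding h_def using M self a
    by (intro holomorphic_on_compose_gen[where t = "ball 0 1"] hol Moebius_function_holomorphic) auto
  show "h 0 = 0"
    by (simp add: h_def Moebius_function_of_zero Moebius_function_eq_zero a)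
  show "cmod (h x) < 1" if "cmod x < 1" for x
    using Moebius_function_norm_lt_1[OF a(1)] M[OF that] self
    by (auto simp: h_def image_subset_iff)
  have n: "1 - cnj \<alpha> * \<alpha> \<noteq> 0" by (rule one_minus_cnj_mult_nonzero[OF a(1) a(1)])
  have d1: "(Moebius_function 0 (- \<alpha>) has_field_derivative (1 - cnj \<alpha> * \<alpha>)) (at 0)"
    unfolding Moebius_function_simple[abs_def]
    by (auto intro!: derivative_eq_intros simp: algebra_simps)
  have d2: "(Moebius_function 0 \<alpha> has_field_derivative 1 / (1 - cnj \<alpha> * \<alpha>)) (at \<alpha>)"
    unfolding Moebius_function_simple[abs_def] using n
    by (auto intro!: derivative_eq_intros simp: divide_simps)
  have d3: "(\<phi> has_field_derivative deriv \<phi> \<alpha>) (at \<alpha>)"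
    using holomorphic_derivI[OF hol open_ball] a by simp
  have M0: "Moebius_function 0 (- \<alpha>) 0 = \<alpha>" by (simp add: Moebius_function_of_zero)
  have "(h has_field_derivative 1 / (1 - cnj \<alpha> * \<alpha>) * (deriv \<phi> \<alpha> * (1 - cnj \<alpha> * \<alpha>))) (at 0)"
    unfolding h_def by (intro DERIV_chain) (simp_all add: M0 a d1 d2 d3)
  then show "deriv h 0 = deriv \<phi> \<alpha>" using n by (simp add: DERIV_imp_deriv)
qed

lemma norm_deriv_fixed_le_1:
  assumes "\<phi> holomorphic_on ball 0 1" "\<phi> ` ball 0 1 \<subseteq> ball 0 1" "cmod \<alpha> < 1" "\<phi> \<alpha> = \<alpha>"
  shows "cmod (deriv \<phi> \<alpha>) \<le> 1"
  using Schwarz_Lemma(2)[OF deriv_fixed_conjugate(1-3)[OF assms], of 0]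
  unfolding deriv_fixed_conjugate(4)[OF assms] by simp

text \<open>The derivative of the conjugate \<open>h\<close> at 0 has modulus exactly 1, so the
  equality case of the Schwarz lemma makes \<open>h\<close> a rotation.\<close>

lemma conjugate_rotation:
  assumes "\<phi> holomorphic_on ball 0 1" "\<phi> ` ball 0 1 \<subseteq> ball 0 1" "cmod \<alpha> < 1" "\<phi> \<alpha> = \<alpha>"
    and "cmod (deriv \<phi> \<alpha>) \<ge> 1"
  obtains \<omega> where "cmod \<omega> = 1"
    "\<And>z. cmod z < 1 \<Longrightarrow> Moebius_function 0 \<alpha> (\<phi> z) = \<omega> * Moebius_function 0 \<alpha> z"
proof -
  define h where "h = Moebius_function 0 \<alpha> \<circ> (\<phi> \<circ> Moebius_function 0 (- \<alpha>))"
  note h = deriv_fixed_conjugate[OF assms(1-4), folded h_def]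
  have "cmod (deriv h 0) = 1"
    using h(4) assms(5) norm_deriv_fixed_le_1[OF assms(1-4)] by simp
  then obtain \<omega> where l: "cmod \<omega> = 1" "\<And>z. cmod z < 1 \<Longrightarrow> h z = \<omega> * z"
    using Schwarz_Lemma(3)[OF h(1-3), of 0] by auto
  show thesis
  proof (rule that[OF l(1)])
    fix z :: complex assume z: "cmod z < 1"
    have "h (Moebius_function 0 \<alpha> z) = \<omega> * Moebius_function 0 \<alpha> z"
      by (rule l(2)[OF Moebius_function_norm_lt_1[OF assms(3) z]])
    then show "Moebius_function 0 \<alpha> (\<phi> z) = \<omega> * Moebius_function 0 \<alpha> z"
      by (simp add: h_def Moebius_function_inverse assms(3) z)
  qed
qed

text \<open>The inverse is also a holomorphic self-map fixing \<open>\<alpha>\<close>, so its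
  derivative there has modulus at most 1, while the two derivatives multiply to 1.\<close>

lemma norm_deriv_fixed_bij:
  assumes hol: "\<phi> holomorphic_on ball 0 1" and inj: "inj_on \<phi> (ball 0 1)"
    and surj: "\<phi> ` ball 0 1 = ball 0 1" and a: "cmod \<alpha> < 1" "\<phi> \<alpha> = \<alpha>"
  shows "cmod (deriv \<phi> \<alpha>) \<ge> 1"
proof -
  obtain g where g: "g holomorphic_on ball 0 1"
      "\<And>z. z \<in> ball 0 1 \<Longrightarrow> deriv \<phi> z * deriv g (\<phi> z) = 1"
      "\<And>z. z \<in> ball 0 1 \<Longrightarrow> g (\<phi> z) = z"
    using holomorphic_has_inverse[OF hol open_ball inj, unfolded surj] by blast
  have "g ` ball 0 1 = g ` \<phi> ` ball 0 1" by (simp only: surj)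
  also have "\<dots> \<subseteq> ball 0 1" using g(3) by auto
  finally have "g ` ball 0 1 \<subseteq> ball 0 1" .
  moreover have "g \<alpha> = \<alpha>" using g(3)[of \<alpha>] a by simp
  ultimately have "cmod (deriv g \<alpha>) \<le> 1" using norm_deriv_fixed_le_1[OF g(1)] a(1) by blast
  moreover have "cmod (deriv \<phi> \<alpha>) * cmod (deriv g \<alpha>) = 1"
    using arg_cong[OF g(2)[of \<alpha>], of cmod] a by (simp add: norm_mult)
  ultimately show ?thesis
    by (metis mult_left_le norm_ge_zero)
qed

subsection \<open>Simultaneous approximation\<close>

text \<open>Cauchy's formula for \<open>F\<close> composed with the inverse of
  \<open>\<psi>\<close>, pulled back to the circle. The difference quotient \<open>q\<close> is
  zero-free by injectivity and equals \<open>deriv \<psi> z\<close> at \<open>z\<close>, so the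
  usual formula applies to \<open>F * deriv \<psi> / q\<close>.\<close>

lemma Cauchy_integral_injective:
  assumes psi: "\<psi> holomorphic_on ball 0 1" "inj_on \<psi> (ball 0 1)"
    and F: "F holomorphic_on ball 0 1" and s: "s < 1" and z: "cmod z < s"
  shows "((\<lambda>\<zeta>. F \<zeta> * deriv \<psi> \<zeta> / (\<psi> \<zeta> - \<psi> z)) has_contour_integral 2 * of_real pi * \<i> * F z)
    (circlepath 0 s)"
proof -
  define q where "q \<zeta> = (if \<zeta> = z then deriv \<psi> z else (\<psi> \<zeta> - \<psi> z) / (\<zeta> - z))" for \<zeta>
  have q: "q holomorphic_on ball 0 1"
    unfolding q_def by (rule pole_lemma_open[OF psi(1) open_ball])
  have dz: "deriv \<psi> z \<noteq> 0"
    using holomorphic_injective_imp_regular[OF psi(1) open_ball psi(2)] z s by simp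
  have q0: "q \<zeta> \<noteq> 0" if "\<zeta> \<in> ball 0 1" for \<zeta>
    using dz inj_onD[OF psi(2), of \<zeta> z] that z s by (auto simp: q_def)
  have "(\<lambda>\<zeta>. F \<zeta> * deriv \<psi> \<zeta> / q \<zeta>) holomorphic_on cball 0 s"
  proof (rule holomorphic_on_subset)
    show "(\<lambda>\<zeta>. F \<zeta> * deriv \<psi> \<zeta> / q \<zeta>) holomorphic_on ball 0 1"
      by (intro holomorphic_intros F q q0 psi) auto
  qed (use s in auto)
  then have "((\<lambda>\<zeta>. F \<zeta> * deriv \<psi> \<zeta> / q \<zeta> / (\<zeta> - z)) has_contour_integral
      2 * of_real pi * \<i> * (F z * deriv \<psi> z / q z)) (circlepath 0 s)"
    using z by (intro Cauchy_integral_circlepath_simple) auto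
  moreover have "F z * deriv \<psi> z / q z = F z" using dz by (simp add: q_def)
  moreover have "F \<zeta> * deriv \<psi> \<zeta> / q \<zeta> / (\<zeta> - z) = F \<zeta> * deriv \<psi> \<zeta> / (\<psi> \<zeta> - \<psi> z)"
    if "\<zeta> \<in> path_image (circlepath 0 s)" for \<zeta>
  proof -
    have "0 < s" using z norm_ge_zero less_le_trans by (meson le_less_trans)
    then have "\<zeta> \<noteq> z" using that z by auto
    then show ?thesis by (simp add: q_def)
  qed
  ultimately show ?thesis
    using has_contour_integral_eq by fastforce
qed

lemma Cauchy_integral_outside:
  assumes psi: "\<psi> holomorphic_on ball 0 1"
    and F: "F holomorphic_on ball 0 1" and s: "0 < s" "s < 1" and w: "w \<notin> \<psi> ` cball 0 s"
  shows "((\<lambda>\<zeta>. F \<zeta> * deriv \<psi> \<zeta> / (\<psi> \<zeta> - w)) has_contour_integral 0) (circlepath 0 s)"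
proof -
  \<comment> \<open>The factor \<open>\<zeta>\<close> makes the integrand
    \<open>q \<zeta> / (\<zeta> - 0)\<close> with \<open>q 0 = 0\<close>, so Cauchy's formula at the
    origin gives 0.\<close>
  define q where "q \<zeta> = \<zeta> * (F \<zeta> * deriv \<psi> \<zeta> / (\<psi> \<zeta> - w))" for \<zeta>
  have sub: "cball (0::complex) s \<subseteq> ball 0 1" using s by auto
  note hol = holomorphic_on_subset[OF _ sub]
  have "q holomorphic_on cball 0 s"
    unfolding q_def using w
    by (intro holomorphic_on_mult holomorphic_on_divide holomorphic_on_diff holomorphic_on_ident
        holomorphic_on_const hol[OF psi] hol[OF F] hol[OF holomorphic_deriv[OF psi open_ball]]) auto
  then have "((\<lambda>\<zeta>. q \<zeta> / (\<zeta> - 0)) has_contour_integral 2 * of_real pi * \<i> * q 0) (circlepath 0 s)"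
    using s by (intro Cauchy_integral_circlepath_simple) auto
  moreover have "q \<zeta> / (\<zeta> - 0) = F \<zeta> * deriv \<psi> \<zeta> / (\<psi> \<zeta> - w)"
    if "\<zeta> \<in> path_image (circlepath 0 s)" for \<zeta>
    using that s by (auto simp: q_def)
  ultimately show ?thesis
    using has_contour_integral_eq[of "\<lambda>\<zeta>. q \<zeta> / (\<zeta> - 0)"] by (fastforce simp: q_def)
qed

text \<open>The function that is 0 on \<open>cball 0 r\<close> and takes the value
  \<open>F z\<close> at \<open>\<psi> z\<close> on \<open>L\<close> is a Cauchy integral over the
  image of the circle of radius \<open>s\<close>. As this curve avoids \<open>X\<close>, pole
  pushing approximates the integral from the disk; adding \<open>f\<close> gives the result.\<close>

lemma simultaneous_approximation:
  assumes psi: "\<psi> holomorphic_on ball 0 1" "\<psi> ` ball 0 1 \<subseteq> ball 0 1" "inj_on \<psi> (ball 0 1)"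
    and r: "0 < r" "r < s" "s < 1" and disj: "\<psi> ` cball 0 s \<inter> cball 0 s = {}"
    and f: "f holomorphic_on ball 0 1" and h: "h holomorphic_on ball 0 1" and "e > 0"
  obtains g where "g holomorphic_on ball 0 1"
    "\<And>z. z \<in> cball 0 r \<Longrightarrow> cmod (g z - f z) < e"
    "\<And>z. z \<in> cball 0 r \<Longrightarrow> cmod (g (\<psi> z) - h z) < e"
proof -
  define L where "L = \<psi> ` cball 0 r"
  define X where "X = cball 0 r \<union> L"
  define F where "F z = h z - f (\<psi> z)" for z
  have rs: "cball (0::complex) r \<subseteq> cball 0 s" and s1: "cball (0::complex) s \<subseteq> ball 0 1"
    using r by auto
  have r1: "cball (0::complex) r \<subseteq> ball 0 1" using rs s1 by blast
  have cont: "continuous_on (cball 0 r) \<psi>"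
    using psi(1) r1 holomorphic_on_imp_continuous_on continuous_on_subset by blast
  have F: "F holomorphic_on ball 0 1"
    unfolding F_def using holomorphic_on_compose_gen[OF psi(1) f psi(2)] h
    by (intro holomorphic_on_diff) (simp_all add: o_def)
  have L: "compact L" unfolding L_def by (intro compact_continuous_image cont) auto
  have X: "compact X" "X \<subseteq> ball 0 1"
    using L r1 psi(2) by (auto simp: X_def L_def)
  have "cball (0::complex) r homeomorphic L"
    by (intro homeomorphic_compact[of _ \<psi>] cont inj_on_subset[OF psi(3) r1]) (auto simp: L_def)
  then have conL: "connected (- L)"
    using homeomorphic_sym
    by (intro connected_complement_homeomorphic_convex_compact[of L "cball (0::complex) r"]) auto
  have disjL: "cball 0 r \<inter> L = {}" using disj rs by (auto simp: L_def)
  \<comment> \<open>Janiszewski's theorem asks for a connected intersection of the two pieces; here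
    it is empty.\<close>
  have conX: "connected (- X)"
    unfolding X_def
    by (intro Janiszewski_connected compact_imp_closed L conL)
      (simp_all add: disjL connected_complement_bounded_convex)
  define \<gamma> where "\<gamma> = circlepath 0 s"
  have g_sphere: "cmod (\<gamma> t) = s" for t using r by (simp add: \<gamma>_def circlepath norm_mult)
  have g_cball: "\<gamma> t \<in> cball 0 s" for t by (simp add: g_sphere)
  have g_ball: "\<gamma> t \<in> ball 0 1" for t using g_sphere[of t] r by simp
  have p_X: "\<psi> (\<gamma> t) \<notin> X" for t
  proof
    assume "\<psi> (\<gamma> t) \<in> X"
    moreover have "\<psi> (\<gamma> t) \<notin> cball 0 r" using disj g_cball[of t] rs by blast
    ultimately obtain z where "z \<in> cball 0 r" "\<psi> (\<gamma> t) = \<psi> z" by (auto simp: X_def L_def)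
    then have "\<gamma> t = z" using inj_onD[OF psi(3)] g_ball r1 by blast
    then show False using \<open>z \<in> cball 0 r\<close> g_sphere[of t] r by simp
  qed
  \<comment> \<open>The Cauchy integrand over the parametrized circle, with
    \<open>2 * pi * \<i>\<close> already cancelled against the derivative of
    \<open>\<gamma>\<close>. The minus sign in \<open>G\<close> comes from writing the kernel with
    its pole as \<open>1 / (w - p)\<close>.\<close>
  define c where "c t = F (\<gamma> t) * deriv \<psi> (\<gamma> t) * (of_real s * exp (2 * of_real pi * \<i> * of_real t))" for t
  define G where "G t w = - c t * (1 / (w - \<psi> (\<gamma> t)))" for t w
  have cont_g: "continuous_on A \<gamma>" for A
    unfolding \<gamma>_def circlepath by (intro continuous_intros)
  have cont_comp: "continuous_on A (\<lambda>t. u (\<gamma> t))" if "u holomorphic_on ball 0 1" for u A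
    using continuous_on_compose2[OF holomorphic_on_imp_continuous_on[OF that] cont_g] g_ball by blast
  have cont_c: "continuous_on {0..1} c"
    unfolding c_def by (intro continuous_intros cont_comp F holomorphic_deriv psi) auto
  have "continuous_on ({0..1} \<times> X) (\<lambda>x. - c (fst x) * (1 / (snd x - \<psi> (\<gamma> (fst x)))))"
  proof (intro continuous_intros)
    show "continuous_on ({0..1} \<times> X) (\<lambda>x. c (fst x))"
      by (rule continuous_on_compose2[OF cont_c]) (auto intro!: continuous_intros)
    show "continuous_on ({0..1} \<times> X) (\<lambda>x. \<psi> (\<gamma> (fst x)))"
      by (rule continuous_on_compose2[OF cont_comp[OF psi(1), of "{0..1}"]]) (auto intro!: continuous_intros)
    show "\<forall>x\<in>{0..1} \<times> X. snd x - \<psi> (\<gamma> (fst x)) \<noteq> 0" using p_X by auto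
  qed
  then have "continuous_on ({0..1} \<times> X) (\<lambda>(t,w). G t w)"
    by (simp add: G_def case_prod_unfold)
  \<comment> \<open>The poles are pushed to the boundary point 1, which lies outside the open
    disk.\<close>
  moreover have "approximable (ball 0 1) X (G t)" for t
    unfolding G_def
    by (intro approximable_cmult approximable_inverse[where a = 1] X conX p_X) auto
  ultimately have app: "approximable (ball 0 1) X (\<lambda>w. integral {0..1} (\<lambda>t. G t w))"
    by (intro approximable_integral X)
  have val: "integral {0..1} (\<lambda>t. G t w) = V"
    if "((\<lambda>\<zeta>. F \<zeta> * deriv \<psi> \<zeta> / (\<psi> \<zeta> - w)) has_contour_integral 2 * of_real pi * \<i> * V) (circlepath 0 s)"
    for w V
  proof -
    have "((\<lambda>t. F (\<gamma> t) * deriv \<psi> (\<gamma> t) / (\<psi> (\<gamma> t) - w) *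
        (2 * of_real pi * \<i> * of_real s * exp (2 * of_real pi * \<i> * of_real t))) has_integral
        2 * of_real pi * \<i> * V) {0..1}"
      using that unfolding has_contour_integral_def \<gamma>_def
      by (rule has_integral_eq[rotated]) (simp add: vector_derivative_circlepath01)
    then have "((\<lambda>t. 1 / (2 * of_real pi * \<i>) * (F (\<gamma> t) * deriv \<psi> (\<gamma> t) / (\<psi> (\<gamma> t) - w) *
        (2 * of_real pi * \<i> * of_real s * exp (2 * of_real pi * \<i> * of_real t)))) has_integral
        1 / (2 * of_real pi * \<i>) * (2 * of_real pi * \<i> * V)) {0..1}"
      by (rule has_integral_mult_right)
    moreover have "1 / (2 * of_real pi * \<i>) * (F (\<gamma> t) * deriv \<psi> (\<gamma> t) / (\<psi> (\<gamma> t) - w) *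
        (2 * of_real pi * \<i> * of_real s * exp (2 * of_real pi * \<i> * of_real t))) = G t w" for t
    proof -
      have "1 / (\<psi> (\<gamma> t) - w) = - (1 / (w - \<psi> (\<gamma> t)))"
        by (metis minus_diff_eq minus_divide_right)
      then have "G t w = c t * (1 / (\<psi> (\<gamma> t) - w))" by (simp add: G_def)
      then show ?thesis by (simp add: c_def field_simps)
    qed
    ultimately show ?thesis by (simp add: integral_unique)
  qed
  have v1: "integral {0..1} (\<lambda>t. G t w) = 0" if "w \<in> cball 0 r" for w
  proof (rule val)
    have "w \<notin> \<psi> ` cball 0 s" using disj rs that by blast
    then show "((\<lambda>\<zeta>. F \<zeta> * deriv \<psi> \<zeta> / (\<psi> \<zeta> - w)) has_contour_integral 2 * of_real pi * \<i> * 0)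
        (circlepath 0 s)"
      using Cauchy_integral_outside[OF psi(1) F _ r(3), of w] r by simp
  qed
  have v2: "integral {0..1} (\<lambda>t. G t (\<psi> z)) = F z" if "z \<in> cball 0 r" for z
    using Cauchy_integral_injective[OF psi(1,3) F r(3), of z] r that
    by (intro val) auto
  obtain g where g: "g holomorphic_on ball 0 1"
    "\<And>w. w \<in> X \<Longrightarrow> cmod (g w - integral {0..1} (\<lambda>t. G t w)) < e"
    using app \<open>e > 0\<close> unfolding approximable_def by blast
  show thesis
  proof (rule that[of "\<lambda>w. f w + g w"])
    show "(\<lambda>w. f w + g w) holomorphic_on ball 0 1" by (intro holomorphic_intros f g)
    show "cmod (f z + g z - f z) < e" if "z \<in> cball 0 r" for z
      using g(2)[of z] v1[OF that] that by (simp add: X_def)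
    show "cmod (f (\<psi> z) + g (\<psi> z) - h z) < e" if "z \<in> cball 0 r" for z
      using g(2)[of "\<psi> z"] v2[OF that] that by (simp add: X_def L_def F_def algebra_simps)
  qed
qed

subsection \<open>Recurrence of composition operators\<close>

lemma funpow_comp_op: "(comp_op \<phi> ^^ k) f = f \<circ> (\<phi> ^^ k)"
proof (induction k)
  case (Suc k)
  show ?case by (simp only: funpow.simps comp_apply Suc) (simp add: comp_op_def fun_eq_iff funpow_swap1)
qed simp

text \<open>A basic neighbourhood of \<open>f\<close> is controlled on a compact set, which lies in
  some \<open>cball 0 r\<close>; it then contains both \<open>g\<close> and its image under the
  \<open>k\<close>-th power of the operator.\<close>

lemma HD_recurrentI:
  assumes hol: "\<phi> holomorphic_on ball 0 1" and self: "\<phi> ` ball 0 1 \<subseteq> ball 0 1"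
    and app: "\<And>f r e. f holomorphic_on ball 0 1 \<Longrightarrow> 0 < r \<Longrightarrow> r < 1 \<Longrightarrow> e > 0 \<Longrightarrow>
      \<exists>k>0. \<exists>g. g holomorphic_on ball 0 1 \<and>
        (\<forall>z\<in>cball 0 r. cmod (g z - f z) < e \<and> cmod (g ((\<phi> ^^ k) z) - f z) < e)"
  shows "HD_recurrent (comp_op \<phi>)"
  unfolding HD_recurrent_def
proof (intro allI impI)
  fix U assume "HD_open U \<and> U \<noteq> {}"
  then obtain f where f: "f \<in> U" and U: "HD_open U" by auto
  have fh: "f holomorphic_on ball 0 1" using f U by (auto simp: HD_open_def HD_def)
  obtain K e where K: "compact K" "K \<subseteq> ball 0 1" and e: "e > 0"
    and near: "\<And>g. g \<in> HD \<Longrightarrow> \<forall>z\<in>K. cmod (g z - f z) < e \<Longrightarrow> g \<in> U"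
    using U f unfolding HD_open_def by metis
  obtain r where r: "0 < r" "r < 1" "K \<subseteq> cball 0 r"
  proof (cases "K = {}")
    case True
    then show thesis using that[of "1/2"] by auto
  next
    case False
    then obtain x where x: "x \<in> K" "\<And>y. y \<in> K \<Longrightarrow> cmod y \<le> cmod x"
      using continuous_attains_sup[OF K(1) False, of cmod] by (auto intro: continuous_intros)
    have "cmod x < 1" using x(1) K(2) by auto
    \<comment> \<open>The lower bound 1/2 keeps the radius positive even if \<open>K\<close> is
      \<open>{0}\<close>.\<close>
    then show thesis
      by (intro that[of "max (cmod x) (1/2)"]) (use x(2) in \<open>auto simp: max.coboundedI1\<close>)
  qed
  obtain k g where k: "k > 0" and g: "g holomorphic_on ball 0 1"
    and gk: "\<And>z. z \<in> cball 0 r \<Longrightarrow> cmod (g z - f z) < e \<and> cmod (g ((\<phi> ^^ k) z) - f z) < e"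
    using app[OF fh r(1,2) e] by metis
  have "g \<circ> (\<phi> ^^ k) holomorphic_on ball 0 1"
    by (rule holomorphic_on_compose_gen[OF funpow_holomorphic[OF hol self] g funpow_self[OF self]])
  then have "g \<circ> (\<phi> ^^ k) \<in> U" using gk r(3) by (intro near) (auto simp: HD_def)
  moreover have "g \<in> U" using gk r(3) g by (intro near) (auto simp: HD_def)
  ultimately show "\<exists>k>0. \<exists>f\<in>U. (comp_op \<phi> ^^ k) f \<in> U"
    using k by (auto simp: funpow_comp_op)
qed

lemma recurrent_if_no_fixed_point:
  assumes hol: "\<phi> holomorphic_on ball 0 1" and self: "\<phi> ` ball 0 1 \<subseteq> ball 0 1"
    and inj: "inj_on \<phi> (ball 0 1)" and nofix: "\<And>z. cmod z < 1 \<Longrightarrow> \<phi> z \<noteq> z"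
  shows "HD_recurrent (comp_op \<phi>)"
proof (rule HD_recurrentI[OF hol self])
  fix f and r e :: real
  assume f: "f holomorphic_on ball 0 1" and r: "0 < r" "r < 1" and e: "e > 0"
  \<comment> \<open>A radius strictly between \<open>r\<close> and 1 leaves room for the Cauchy
    contour around \<open>cball 0 r\<close>; both target functions will be \<open>f\<close>.\<close>
  define s where "s = (1 + r) / 2"
  have s: "r < s" "s < 1" using r by (auto simp: s_def)
  obtain k where k: "k > 0" "(\<phi> ^^ k) ` cball 0 s \<inter> cball 0 s = {}"
    using iterates_escape[OF hol self nofix, of s] r s by auto
  obtain g where "g holomorphic_on ball 0 1"
    "\<And>z. z \<in> cball 0 r \<Longrightarrow> cmod (g z - f z) < e"
    "\<And>z. z \<in> cball 0 r \<Longrightarrow> cmod (g ((\<phi> ^^ k) z) - f z) < e"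
    using simultaneous_approximation[OF funpow_holomorphic[OF hol self] funpow_self[OF self]
        funpow_inj_on[OF inj self] r(1) s k(2) f f e] by metis
  then show "\<exists>k>0. \<exists>g. g holomorphic_on ball 0 1 \<and>
        (\<forall>z\<in>cball 0 r. cmod (g z - f z) < e \<and> cmod (g ((\<phi> ^^ k) z) - f z) < e)"
    using k(1) by blast
qed

section \<open>Recurrence for elliptic automorphisms\<close>

text \<open>By compactness of the circle two distinct powers come close, and dividing one by the
  other preserves the distance.\<close>

lemma unimodular_power_near_1:
  assumes "cmod \<omega> = 1" "d > 0"
  obtains k :: nat where "k > 0" "cmod (\<omega> ^ k - 1) < d"
proof -
  have "\<forall>n. \<omega> ^ n \<in> sphere 0 1" using assms by (simp add: norm_power)
  then obtain l \<sigma> where "strict_mono (\<sigma> :: nat \<Rightarrow> nat)" and lim: "((\<lambda>n. \<omega> ^ n) \<circ> \<sigma>) \<longlonglongrightarrow> l"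
    using compact_sphere[of "0::complex" 1] unfolding compact_def by blast
  from lim have "Cauchy ((\<lambda>n. \<omega> ^ n) \<circ> \<sigma>)" by (rule LIMSEQ_imp_Cauchy)
  then obtain M where M: "\<And>m n. m \<ge> M \<Longrightarrow> n \<ge> M \<Longrightarrow> cmod (\<omega> ^ \<sigma> m - \<omega> ^ \<sigma> n) < d"
    using assms(2) unfolding Cauchy_def dist_norm comp_def by blast
  have lt: "\<sigma> M < \<sigma> (Suc M)" using \<open>strict_mono \<sigma>\<close> by (simp add: strict_mono_def)
  define k where "k = \<sigma> (Suc M) - \<sigma> M"
  have "\<omega> ^ \<sigma> (Suc M) - \<omega> ^ \<sigma> M = \<omega> ^ \<sigma> M * (\<omega> ^ k - 1)"
    using lt by (simp add: k_def algebra_simps flip: power_add)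
  then have "cmod (\<omega> ^ \<sigma> (Suc M) - \<omega> ^ \<sigma> M) = cmod (\<omega> ^ k - 1)"
    using assms(1) by (simp add: norm_mult norm_power)
  with M[of "Suc M" M] lt show thesis by (intro that[of k]) (auto simp: k_def)
qed

text \<open>In the coordinate that moves \<open>\<alpha>\<close> to 0, \<open>\<phi>\<close> is
  multiplication by \<open>\<omega>\<close>. A power of \<open>\<omega>\<close> near 1 makes the
  iterate nearly the identity on compact sets, so \<open>f\<close> itself serves as
  \<open>g\<close>.\<close>

lemma recurrent_if_elliptic:
  assumes hol: "\<phi> holomorphic_on ball 0 1" and self: "\<phi> ` ball 0 1 \<subseteq> ball 0 1"
    and "elliptic_aut \<phi>"
  shows "HD_recurrent (comp_op \<phi>)"
proof (rule HD_recurrentI[OF hol self])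
  obtain \<alpha> where a: "cmod \<alpha> < 1" "\<phi> \<alpha> = \<alpha>" and "disk_mobius_aut \<phi>"
    using assms(3) by (auto simp: elliptic_aut_def)
  then obtain a b c d where abcd: "a * d - b * c \<noteq> 0"
    "\<And>z. z \<in> ball 0 1 \<Longrightarrow> c * z + d \<noteq> 0 \<and> \<phi> z = (a * z + b) / (c * z + d)"
    and surj: "\<phi> ` ball 0 1 = ball 0 1"
    unfolding disk_mobius_aut_def by blast
  have inj: "inj_on \<phi> (ball 0 1)"
  proof (rule inj_onI)
    fix z w :: complex assume zw: "z \<in> ball 0 1" "w \<in> ball 0 1" "\<phi> z = \<phi> w"
    then have "(a * z + b) * (c * w + d) = (a * w + b) * (c * z + d)"
      using abcd(2)[OF zw(1)] abcd(2)[OF zw(2)] by (simp add: frac_eq_eq)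
    then have "(a * d - b * c) * (z - w) = 0" by (simp add: algebra_simps)
    then show "z = w" using abcd(1) by simp
  qed
  obtain \<omega> where w: "cmod \<omega> = 1"
    "\<And>z. cmod z < 1 \<Longrightarrow> Moebius_function 0 \<alpha> (\<phi> z) = \<omega> * Moebius_function 0 \<alpha> z"
    using conjugate_rotation[OF hol self a norm_deriv_fixed_bij[OF hol inj surj a]] by metis
  have lt: "cmod ((\<phi> ^^ k) z) < 1" if "cmod z < 1" for k z
    using funpow_self[OF self, of k] that by (auto simp: image_subset_iff)
  have wk: "Moebius_function 0 \<alpha> ((\<phi> ^^ k) z) = \<omega> ^ k * Moebius_function 0 \<alpha> z" if "cmod z < 1" for k z
    by (induction k) (simp_all add: w(2) lt that)
  fix f and r e :: real
  assume f: "f holomorphic_on ball 0 1" and r: "0 < r" "r < 1" and e: "e > 0"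
  define F where "F = f \<circ> Moebius_function 0 (- \<alpha>)"
  define R where "R = Moebius_function 0 \<alpha> ` cball 0 r"
  have cR: "compact R"
    unfolding R_def
  proof (intro compact_continuous_image)
    have "Moebius_function 0 \<alpha> holomorphic_on cball 0 r"
      by (rule holomorphic_on_subset[OF Moebius_function_holomorphic[OF a(1)]]) (use r in auto)
    then show "continuous_on (cball 0 r) (Moebius_function 0 \<alpha>)"
      by (rule holomorphic_on_imp_continuous_on)
  qed auto
  \<comment> \<open>All rotations of \<open>R\<close>: this set holds \<open>x\<close> and
    \<open>\<omega> ^ k * x\<close> for every \<open>k\<close>, so \<open>\<delta>\<close> can be
    fixed before \<open>k\<close>.\<close>
  define R' where "R' = (\<lambda>(u, v). u * v) ` (sphere 0 1 \<times> R)"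
  have cR': "compact R'"
    unfolding R'_def by (intro compact_continuous_image compact_Times cR)
      (auto simp: case_prod_unfold intro!: continuous_intros)
  have R1: "R \<subseteq> ball 0 1"
    using Moebius_function_norm_lt_1[OF a(1)] r by (auto simp: R_def)
  then have R'1: "R' \<subseteq> ball 0 1" by (auto simp: R'_def norm_mult)
  have Fh: "F holomorphic_on ball 0 1"
    unfolding F_def using Moebius_function_norm_lt_1[of "- \<alpha>"] a
    by (intro holomorphic_on_compose_gen[where t = "ball 0 1"] Moebius_function_holomorphic f) auto
  have "uniformly_continuous_on R' F"
    using Fh R'1 cR' holomorphic_on_imp_continuous_on continuous_on_subset
      compact_uniformly_continuous by blast
  then obtain \<delta> where \<delta>: "\<delta> > 0"
    "\<And>x y. x \<in> R' \<Longrightarrow> y \<in> R' \<Longrightarrow> cmod (y - x) < \<delta> \<Longrightarrow> cmod (F y - F x) < e"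
    using e unfolding uniformly_continuous_on_def dist_norm by metis
  obtain k where k: "k > 0" "cmod (\<omega> ^ k - 1) < \<delta>"
    using unimodular_power_near_1[OF w(1) \<delta>(1)] by blast
  have "cmod (f ((\<phi> ^^ k) z) - f z) < e" if z: "z \<in> cball 0 r" for z
  proof -
    have z1: "cmod z < 1" using z r by simp
    define x where "x = Moebius_function 0 \<alpha> z"
    have xR: "x \<in> R" using z by (auto simp: R_def x_def)
    have "cmod x < 1" using xR R1 by auto
    then have "x \<in> R'" using xR unfolding R'_def by (force intro!: rev_image_eqI[of "(1, x)"])
    moreover have "\<omega> ^ k * x \<in> R'"
      using xR w(1) unfolding R'_def by (intro rev_image_eqI[of "(\<omega> ^ k, x)"]) (auto simp: norm_power)
    moreover have "cmod (\<omega> ^ k * x - x) < \<delta>"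
    proof -
      have "\<omega> ^ k * x - x = (\<omega> ^ k - 1) * x" by (simp add: algebra_simps)
      moreover have "cmod ((\<omega> ^ k - 1) * x) \<le> cmod (\<omega> ^ k - 1)"
        unfolding norm_mult using \<open>cmod x < 1\<close> by (intro mult_left_le) auto
      ultimately show ?thesis using k(2) by simp
    qed
    ultimately have "cmod (F (\<omega> ^ k * x) - F x) < e" by (rule \<delta>(2))
    moreover have "F x = f z" by (simp add: F_def x_def Moebius_function_inverse a z1)
    moreover have "F (\<omega> ^ k * x) = f ((\<phi> ^^ k) z)"
      by (simp add: F_def x_def Moebius_function_inverse a z1 lt flip: wk)
    ultimately show ?thesis by simp
  qed
  then show "\<exists>k>0. \<exists>g. g holomorphic_on ball 0 1 \<and>
        (\<forall>z\<in>cball 0 r. cmod (g z - f z) < e \<and> cmod (g ((\<phi> ^^ k) z) - f z) < e)"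
    using k(1) f e by (intro exI[of _ k] conjI exI[of _ f]) auto
qed

section \<open>Necessary conditions for recurrence\<close>

lemma elliptic_if_norm_deriv_ge_1:
  assumes hol: "\<phi> holomorphic_on ball 0 1" and self: "\<phi> ` ball 0 1 \<subseteq> ball 0 1"
    and a: "cmod \<alpha> < 1" "\<phi> \<alpha> = \<alpha>" and ge: "cmod (deriv \<phi> \<alpha>) \<ge> 1"
  shows "elliptic_aut \<phi>"
proof -
  obtain \<omega> where w: "cmod \<omega> = 1"
    "\<And>z. cmod z < 1 \<Longrightarrow> Moebius_function 0 \<alpha> (\<phi> z) = \<omega> * Moebius_function 0 \<alpha> z"
    using conjugate_rotation[OF hol self a ge] by metis
  have w0: "\<omega> \<noteq> 0" using w(1) by auto
  have lt: "cmod (\<phi> z) < 1" if "cmod z < 1" for z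
    using self that by (auto simp: image_subset_iff)
  \<comment> \<open>Coefficients obtained by solving the rotation equation for
    \<open>\<phi> z\<close> and multiplying numerator and denominator by
    \<open>1 - cnj \<alpha> * z\<close>.\<close>
  define A B C D where "A = \<omega> - \<alpha> * cnj \<alpha>" and "B = \<alpha> * (1 - \<omega>)"
    and "C = cnj \<alpha> * (\<omega> - 1)" and "D = 1 - \<omega> * (\<alpha> * cnj \<alpha>)"
  have "A * D - B * C = \<omega> * (1 - cnj \<alpha> * \<alpha>)\<^sup>2"
    by (simp add: A_def B_def C_def D_def power2_eq_square algebra_simps)
  then have "A * D - B * C \<noteq> 0"
    using w0 one_minus_cnj_mult_nonzero[OF a(1) a(1)] by simp
  moreover have "C * z + D \<noteq> 0 \<and> \<phi> z = (A * z + B) / (C * z + D)" if "z \<in> ball 0 1" for z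
  proof -
    have z: "cmod z < 1" using that by simp
    define x where "x = \<omega> * Moebius_function 0 \<alpha> z"
    have x1: "cmod x < 1"
      using Moebius_function_norm_lt_1[OF a(1) z] w(1) by (simp add: x_def norm_mult)
    have n: "1 - cnj \<alpha> * z \<noteq> 0" by (rule one_minus_cnj_mult_nonzero[OF z a(1)])
    have m: "1 + cnj \<alpha> * x \<noteq> 0" using one_minus_cnj_mult_nonzero[OF x1, of "- \<alpha>"] a by simp
    have "\<phi> z = Moebius_function 0 (- \<alpha>) x"
      using Moebius_function_inverse[OF a(1) lt[OF z]] by (simp add: w(2) z x_def)
    also have "\<dots> = (x + \<alpha>) / (1 + cnj \<alpha> * x)" by (simp add: Moebius_function_simple)
    finally have eq: "\<phi> z = (x + \<alpha>) / (1 + cnj \<alpha> * x)" .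
    have xn: "x * (1 - cnj \<alpha> * z) = \<omega> * (z - \<alpha>)"
      using n by (simp add: x_def Moebius_function_simple)
    have num: "A * z + B = (x + \<alpha>) * (1 - cnj \<alpha> * z)"
      unfolding distrib_right xn by (simp add: A_def B_def algebra_simps)
    have "C * z + D = 1 * (1 - cnj \<alpha> * z) + cnj \<alpha> * (x * (1 - cnj \<alpha> * z))"
      unfolding xn by (simp add: C_def D_def algebra_simps)
    then have "C * z + D = (1 + cnj \<alpha> * x) * (1 - cnj \<alpha> * z)"
      by (simp add: algebra_simps)
    then show ?thesis using n m eq num by simp
  qed
  moreover have "ball 0 1 \<subseteq> \<phi> ` ball 0 1"
  proof
    fix y :: complex assume "y \<in> ball 0 1"
    then have y: "cmod y < 1" by simp
    \<comment> \<open>A preimage of \<open>y\<close> arises by undoing the rotation in the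
      coordinate centred at \<open>\<alpha>\<close>.\<close>
    define x where "x = Moebius_function 0 \<alpha> y / \<omega>"
    define z where "z = Moebius_function 0 (- \<alpha>) x"
    have x1: "cmod x < 1"
      using Moebius_function_norm_lt_1[OF a(1) y] w(1) by (simp add: x_def norm_divide)
    have z1: "cmod z < 1"
      unfolding z_def using a x1 by (intro Moebius_function_norm_lt_1) auto
    have "Moebius_function 0 \<alpha> z = x"
      using Moebius_function_inverse[of "- \<alpha>" x] a x1 by (simp add: z_def)
    then have "Moebius_function 0 \<alpha> (\<phi> z) = Moebius_function 0 \<alpha> y"
      using w0 by (simp add: w(2) z1 x_def)
    then have "\<phi> z = y"
      using Moebius_function_inverse[OF a(1) lt[OF z1]] Moebius_function_inverse[OF a(1) y] by metis
    then show "y \<in> \<phi> ` ball 0 1" using z1 by force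
  qed
  ultimately have "disk_mobius_aut \<phi>"
    unfolding disk_mobius_aut_def using self
    by (intro exI[of _ A] exI[of _ B] exI[of _ C] exI[of _ D] conjI ballI equalityI) simp_all
  then show ?thesis using a by (auto simp: elliptic_aut_def)
qed

text \<open>If \<open>\<phi>\<close> identifies \<open>a\<close> and \<open>b\<close>, so does every
  positive iterate, and no image under a positive power of the operator can separate them.\<close>

lemma inj_on_if_recurrent:
  assumes "HD_recurrent (comp_op \<phi>)"
  shows "inj_on \<phi> (ball 0 1)"
proof (rule inj_onI, rule ccontr)
  fix a b :: complex assume ab: "a \<in> ball 0 1" "b \<in> ball 0 1" "\<phi> a = \<phi> b" "a \<noteq> b"
  define U where "U = {f \<in> HD. f a \<noteq> f b}"
  have "HD_open U"
    unfolding HD_open_def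
  proof (intro conjI ballI)
    fix f assume f: "f \<in> U"
    \<comment> \<open>Moving each value by less than half the gap cannot close it.\<close>
    define e where "e = cmod (f a - f b) / 2"
    have "g \<in> U" if "g \<in> HD" "\<forall>z\<in>{a, b}. cmod (g z - f z) < e" for g
    proof -
      have "cmod (f a - f b) \<le> cmod (g a - f a) + cmod (g b - f b)" if "g a = g b"
        using norm_triangle_ineq4[of "g b - f b" "g a - f a"] that by simp
      then show ?thesis using that by (auto simp: U_def e_def)
    qed
    moreover have "e > 0" using f by (simp add: U_def e_def)
    ultimately show "\<exists>K e. compact K \<and> K \<subseteq> ball 0 1 \<and> e > 0 \<and>
        (\<forall>g\<in>HD. (\<forall>z\<in>K. cmod (g z - f z) < e) \<longrightarrow> g \<in> U)"
      using ab by (intro exI[of _ "{a, b}"] exI[of _ e]) auto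
  qed (auto simp: U_def)
  moreover have "(\<lambda>z. z) \<in> U" using ab by (simp add: U_def HD_def)
  ultimately obtain k f where k: "k > 0" "(comp_op \<phi> ^^ k) f \<in> U"
    using assms unfolding HD_recurrent_def by blast
  then obtain j where "k = Suc j" by (cases k) auto
  then have "(\<phi> ^^ k) a = (\<phi> ^^ k) b" using ab by (simp add: funpow_swap1)
  then show False using k(2) by (simp add: funpow_comp_op U_def)
qed

text \<open>Composition with the \<open>k\<close>-th iterate multiplies the derivative at
  \<open>\<alpha>\<close> by \<open>deriv \<phi> \<alpha> ^ k\<close>. If that derivative has
  modulus \<open>l < 1\<close>, a function with derivative of modulus below 1 is sent to one with
  modulus at most \<open>l\<close>, outside \<open>U\<close>.\<close>

lemma norm_deriv_fixed_if_recurrent: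
  assumes hol: "\<phi> holomorphic_on ball 0 1" and self: "\<phi> ` ball 0 1 \<subseteq> ball 0 1"
    and a: "cmod \<alpha> < 1" "\<phi> \<alpha> = \<alpha>" and rec: "HD_recurrent (comp_op \<phi>)"
  shows "cmod (deriv \<phi> \<alpha>) \<ge> 1"
proof (rule ccontr)
  define l where "l = cmod (deriv \<phi> \<alpha>)"
  assume "\<not> ?thesis"
  then have l: "0 \<le> l" "l < 1" by (auto simp: l_def)
  define U where "U = {f \<in> HD. l < cmod (deriv f \<alpha>) \<and> cmod (deriv f \<alpha>) < 1}"
  \<comment> \<open>Half the distance from \<open>\<alpha>\<close> to the unit circle, so Cauchy's
    inequality on \<open>cball \<alpha> \<rho>\<close> stays inside the disk.\<close>
  define \<rho> where "\<rho> = (1 - cmod \<alpha>) / 2"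
  have \<rho>: "\<rho> > 0" "cball \<alpha> \<rho> \<subseteq> ball 0 1"
  proof -
    show "\<rho> > 0" using a by (simp add: \<rho>_def)
    show "cball \<alpha> \<rho> \<subseteq> ball 0 1"
    proof
      fix z assume "z \<in> cball \<alpha> \<rho>"
      then have "cmod (z - \<alpha>) \<le> \<rho>" by (simp add: dist_norm norm_minus_commute)
      then have "cmod z \<le> cmod \<alpha> + \<rho>" using norm_triangle_sub[of z \<alpha>] by simp
      then show "z \<in> ball 0 1" using a(1) by (simp add: \<rho>_def field_simps)
    qed
  qed
  have est: "cmod (deriv g \<alpha> - deriv f \<alpha>) \<le> e / \<rho>"
    if f: "f holomorphic_on ball 0 1" and g: "g holomorphic_on ball 0 1"
      and near: "\<forall>z\<in>cball \<alpha> \<rho>. cmod (g z - f z) < e" for f g e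
  proof -
    have h: "(\<lambda>z. g z - f z) holomorphic_on ball 0 1" by (intro holomorphic_intros f g)
    have "cmod ((deriv ^^ 1) (\<lambda>z. g z - f z) \<alpha>) \<le> fact 1 * e / \<rho> ^ 1"
    proof (rule Cauchy_inequality)
      show "(\<lambda>z. g z - f z) holomorphic_on ball \<alpha> \<rho>"
        using h \<rho>(2) ball_subset_cball holomorphic_on_subset by blast
      show "continuous_on (cball \<alpha> \<rho>) (\<lambda>z. g z - f z)"
        using h \<rho>(2) holomorphic_on_imp_continuous_on holomorphic_on_subset by blast
      show "cmod (g x - f x) \<le> e" if "cmod (\<alpha> - x) = \<rho>" for x
        using near that by (intro less_imp_le) (simp add: dist_norm)
    qed (rule \<rho>(1))
    moreover have "deriv (\<lambda>z. g z - f z) \<alpha> = deriv g \<alpha> - deriv f \<alpha>"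
      using f g a holomorphic_on_imp_differentiable_at[OF _ open_ball, of _ 0 1 \<alpha>]
      by (intro deriv_diff) auto
    ultimately show ?thesis by simp
  qed
  have "HD_open U"
    unfolding HD_open_def
  proof (intro conjI ballI)
    fix f assume f: "f \<in> U"
    \<comment> \<open>Half the smaller margin of \<open>f\<close> in \<open>U\<close>; values within
      \<open>m * \<rho>\<close> force derivatives within \<open>m\<close>.\<close>
    define m where "m = min (cmod (deriv f \<alpha>) - l) (1 - cmod (deriv f \<alpha>)) / 2"
    have m: "m > 0" "2 * m \<le> cmod (deriv f \<alpha>) - l" "2 * m \<le> 1 - cmod (deriv f \<alpha>)"
      using f by (auto simp: U_def m_def)
    have "g \<in> U" if "g \<in> HD" "\<forall>z\<in>cball \<alpha> \<rho>. cmod (g z - f z) < m * \<rho>" for g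
    proof -
      have "cmod (deriv g \<alpha> - deriv f \<alpha>) \<le> m"
        using est[of f g "m * \<rho>"] that f \<rho>(1) by (auto simp: U_def HD_def)
      then have "\<bar>cmod (deriv g \<alpha>) - cmod (deriv f \<alpha>)\<bar> \<le> m"
        using norm_triangle_ineq3[of "deriv g \<alpha>" "deriv f \<alpha>"] by simp
      then have "l < cmod (deriv g \<alpha>)" "cmod (deriv g \<alpha>) < 1" using m by linarith+
      then show ?thesis using that(1) by (simp add: U_def)
    qed
    then show "\<exists>K e. compact K \<and> K \<subseteq> ball 0 1 \<and> e > 0 \<and>
        (\<forall>g\<in>HD. (\<forall>z\<in>K. cmod (g z - f z) < e) \<longrightarrow> g \<in> U)"
      using \<rho> m(1) by (intro exI[of _ "cball \<alpha> \<rho>"] exI[of _ "m * \<rho>"]) auto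
  qed (auto simp: U_def)
  \<comment> \<open>The slope is the midpoint of \<open>l\<close> and 1, which makes
    \<open>U\<close> nonempty.\<close>
  moreover have "(\<lambda>z. of_real ((1 + l) / 2) * z) \<in> U"
  proof -
    have "deriv (\<lambda>z. of_real ((1 + l) / 2) * z) \<alpha> = (of_real ((1 + l) / 2) :: complex)"
      by (intro DERIV_imp_deriv derivative_eq_intros) auto
    moreover have "(\<lambda>z::complex. of_real ((1 + l) / 2) * z) holomorphic_on ball 0 1"
      by (intro holomorphic_intros)
    ultimately show ?thesis using l by (simp add: U_def HD_def del: of_real_divide of_real_add)
  qed
  ultimately obtain k f where k: "k > 0" "f \<in> U" "(comp_op \<phi> ^^ k) f \<in> U"
    using rec unfolding HD_recurrent_def by blast
  have dphi: "(\<phi> has_field_derivative deriv \<phi> \<alpha>) (at \<alpha>)"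
    using holomorphic_derivI[OF hol open_ball] a by simp
  have fixed: "(\<phi> ^^ n) \<alpha> = \<alpha>" for n by (induction n) (simp_all add: a)
  have dk: "((\<phi> ^^ n) has_field_derivative deriv \<phi> \<alpha> ^ n) (at \<alpha>)" for n
  proof (induction n)
    case 0 show ?case by (simp add: id_def)
  next
    case (Suc n)
    then show ?case using DERIV_chain[of \<phi> _ "\<phi> ^^ n"] dphi
      by (simp only: funpow.simps power_Suc fixed)
  qed
  have "(f has_field_derivative deriv f \<alpha>) (at \<alpha>)"
    using k(2) a holomorphic_derivI[OF _ open_ball, of f 0 1 \<alpha>] by (simp add: U_def HD_def)
  then have "(f \<circ> (\<phi> ^^ k) has_field_derivative deriv f \<alpha> * deriv \<phi> \<alpha> ^ k) (at \<alpha>)"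
    using DERIV_chain[of f _ "\<phi> ^^ k", OF _ dk] by (simp only: fixed)
  then have "deriv (f \<circ> (\<phi> ^^ k)) \<alpha> = deriv f \<alpha> * deriv \<phi> \<alpha> ^ k" by (rule DERIV_imp_deriv)
  then have "cmod (deriv (f \<circ> (\<phi> ^^ k)) \<alpha>) = cmod (deriv f \<alpha>) * l ^ k"
    by (simp add: norm_mult norm_power l_def)
  \<comment> \<open>Here \<open>k > 0\<close> is essential: at least one factor \<open>l\<close>
    survives.\<close>
  also have "\<dots> \<le> 1 * l ^ 1"
    using k l by (intro mult_mono power_decreasing) (auto simp: U_def)
  finally show False using k(3) by (simp add: funpow_comp_op U_def)
qed

theorem theorem6p9:
  fixes \<phi> :: "complex \<Rightarrow> complex"
  assumes "\<phi> holomorphic_on unit_disk" and "\<phi> ` unit_disk \<subseteq> unit_disk"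
  shows "HD_recurrent (comp_op \<phi>) \<longleftrightarrow>
           ((inj_on \<phi> unit_disk \<and> (\<forall>z\<in>unit_disk. \<phi> z \<noteq> z)) \<or> elliptic_aut \<phi>)"
proof
  assume rec: "HD_recurrent (comp_op \<phi>)"
  show "(inj_on \<phi> unit_disk \<and> (\<forall>z\<in>unit_disk. \<phi> z \<noteq> z)) \<or> elliptic_aut \<phi>"
  proof (cases "\<forall>z\<in>unit_disk. \<phi> z \<noteq> z")
    case True
    then show ?thesis using inj_on_if_recurrent[OF rec] by blast
  next
    case False
    then obtain \<alpha> where "cmod \<alpha> < 1" "\<phi> \<alpha> = \<alpha>" by auto
    then show ?thesis
      using elliptic_if_norm_deriv_ge_1 norm_deriv_fixed_if_recurrent rec assms by blast
  qed
next
  assume "(inj_on \<phi> unit_disk \<and> (\<forall>z\<in>unit_disk. \<phi> z \<noteq> z)) \<or> elliptic_aut \<phi>"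
  then show "HD_recurrent (comp_op \<phi>)"
    using recurrent_if_no_fixed_point[OF assms] recurrent_if_elliptic[OF assms] by auto
qed

end
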